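(* Let $k\ge 1$ and $n\ge 1$ be integers, let $\mathcal{V}\subseteq\{0,1,\dots,k-1\}^n\subseteq\mathbb{Q}^n$ be a finite point set, and let $\prec$ be the lexicographic order on the monomials of $\mathbb{Q}[x_1,\dots,x_n]$ for which $x_{i_1}\succ x_{i_2}\succ\dots\succ x_{i_n}$, where $(i_1,\dots,i_n)$ is a permutation of $[n]$. Then $$\mathrm{Sm}(I(\mathcal{V}))=D_{i_n,i_{n-1},\dots,i_1}(\mathcal{V}),$$ where standard monomials are taken with respect to $\prec$ and a monomial $x^{\mathbf w}=x_1^{w_1}\cdots x_n^{w_n}$ is identified with its exponent vector $\mathbf w\in\mathbb{Z}_{\ge0}^n$.
   Context: For a finite set $\mathcal{V}\subseteq\mathbb{F}^n$ ($\mathbb{F}$ a field), the vanishing ideal is $I(\mathcal{V})=\{f\in\mathbb{F}[x_1,\dots,x_n]: f(\mathbf v)=0\ \forall \mathbf v\in\mathcal{V}\}$. A term order is a total order on monomials with $1$ minimal and compatible with multiplication by monomials. The lexicographic order with $x_{i_1}\succ\dots\succ x_{i_n}$: $x^{\mathbf w}\prec x^{\mathbf u}$ iff for the smallest $j$ with $w_{i_j}\ne u_{i_j}$ one has $w_{i_j}<u_{i_j}$. For a nonzero polynomial $f$, its leading monomial is the $\prec$-largest monomial with nonzero coefficient in $f$; a monomial is a standard monomial of an ideal $I$ if it is not the leading monomial of any nonzero $f\in I$; $\mathrm{Sm}(I)$ denotes the set of standard monomials. For $\mathcal{V}\subseteq\{0,\dots,k-1\}^n$ and $i\in[n]$, the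 $i$-section at $(\alpha_1,\dots,\alpha_{i-1},\alpha_{i+1},\dots,\alpha_n)$ is $\mathcal{V}_i(\alpha_1,\dots,\alpha_{i-1},\alpha_{i+1},\dots,\alpha_n)=\{\alpha:(\alpha_1,\dots,\alpha_{i-1},\alpha,\alpha_{i+1},\dots,\alpha_n)\in\mathcal{V}\}$. The downshift $D_i(\mathcal{V})$ is the unique subset of $\{0,\dots,k-1\}^n$ whose $i$-section at each $(\alpha_1,\dots,\alpha_{i-1},\alpha_{i+1},\dots,\alpha_n)$ equals $\{0,1,\dots,|\mathcal{V}_i(\alpha_1,\dots,\alpha_{i-1},\alpha_{i+1},\dots,\alpha_n)|-1\}$ when that section of $\mathcal{V}$ is nonempty, and is empty otherwise. For indices $j_1,\dots,j_\ell$, $D_{j_1,j_2,\dots,j_\ell}(\mathcal{V}):=D_{j_1}(D_{j_2}(\cdots(D_{j_\ell}(\mathcal{V}))))$. *)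

theory Defs
  imports "HOL-Analysis.Finite_Cartesian_Product" "HOL-Library.Poly_Mapping"
begin

text \<open>
  The coordinates are indexed by a finite type \<open>'n\<close>, so that the dimension is \<open>CARD('n)\<close>.
  A monomial is its exponent vector in \<open>nat ^ 'n\<close>; the addition of \<open>nat ^ 'n\<close> is
  componentwise, hence the convolution product of the type below is the usual product of
  polynomials.
\<close>

type_synonym ('a, 'n) mpoly = "(nat ^ 'n) \<Rightarrow>\<^sub>0 'a"

definition eval :: "('a::field, 'n::finite) mpoly \<Rightarrow> 'a ^ 'n \<Rightarrow> 'a" where
  "eval f v =
    (\<Sum>w\<in>Poly_Mapping.keys f. Poly_Mapping.lookup f w * (\<Prod>i\<in>UNIV. (v $ i) ^ (w $ i)))"

definition vanishing_ideal :: "('a::field ^ 'n::finite) set \<Rightarrow> ('a, 'n) mpoly set" where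
  "vanishing_ideal P = {f. \<forall>v\<in>P. eval f v = 0}"

text \<open>The list \<open>idx\<close> enumerates the variables from the largest to the smallest one.\<close>

definition lex_less :: "'n::finite list \<Rightarrow> nat ^ 'n \<Rightarrow> nat ^ 'n \<Rightarrow> bool" where
  "lex_less idx w u \<longleftrightarrow>
    (\<exists>j<length idx. (\<forall>l<j. w $ (idx ! l) = u $ (idx ! l)) \<and> w $ (idx ! j) < u $ (idx ! j))"

definition is_leading_monomial ::
  "(nat ^ 'n \<Rightarrow> nat ^ 'n \<Rightarrow> bool) \<Rightarrow> ('a::field, 'n::finite) mpoly \<Rightarrow> nat ^ 'n \<Rightarrow> bool" where
  "is_leading_monomial prec f w \<longleftrightarrow>
    w \<in> Poly_Mapping.keys f \<and> (\<forall>u\<in>Poly_Mapping.keys f. u \<noteq> w \<longrightarrow> prec u w)"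

definition standard_monomials ::
  "(nat ^ 'n \<Rightarrow> nat ^ 'n \<Rightarrow> bool) \<Rightarrow> ('a::field, 'n::finite) mpoly set \<Rightarrow> (nat ^ 'n) set" where
  "standard_monomials prec I = {w. \<not> (\<exists>f\<in>I. f \<noteq> 0 \<and> is_leading_monomial prec f w)}"

text \<open>
  The section of \<open>V\<close> in direction \<open>i\<close> at \<open>a\<close>; the component \<open>a $ i\<close> is ignored.
\<close>

definition isection :: "'n::finite \<Rightarrow> (nat ^ 'n) set \<Rightarrow> nat ^ 'n \<Rightarrow> nat set" where
  "isection i V a = {\<alpha>. (\<chi> j. if j = i then \<alpha> else a $ j) \<in> V}"

definition downshift :: "'n::finite \<Rightarrow> (nat ^ 'n) set \<Rightarrow> (nat ^ 'n) set" where
  "downshift i V = {a. a $ i < card (isection i V a)}"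

definition downshifts :: "'n::finite list \<Rightarrow> (nat ^ 'n) set \<Rightarrow> (nat ^ 'n) set" where
  "downshifts js V = foldr downshift js V"

lemma downshifts_simps [simp]:
  "downshifts [] V = V"
  "downshifts (j # js) V = downshift j (downshifts js V)"
  by (simp_all add: downshifts_def)

definition cube :: "nat \<Rightarrow> (nat ^ 'n::finite) set" where
  "cube k = {v. \<forall>i. v $ i \<in> {0..<k}}"

definition rat_point :: "nat ^ 'n::finite \<Rightarrow> rat ^ 'n" where
  "rat_point v = (\<chi> i. of_nat (v $ i))"

text \<open>
  The next facts show that \<open>downshift i V\<close> is the unique set in the cube whose sections in
  direction \<open>i\<close> are the initial segments with the cardinalities of the sections of \<open>V\<close>.
\<close>

lemma isection_self: "a \<in> V \<longleftrightarrow> a $ i \<in> isection i V a"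
proof -
  have "(\<chi> j. if j = i then a $ i else a $ j) = a"
    by (simp add: vec_eq_iff)
  then show ?thesis by (simp add: isection_def)
qed

lemma isection_upd: "isection i V (\<chi> j. if j = i then \<alpha> else a $ j) = isection i V a"
proof -
  have "(\<chi> j. if j = i then \<beta> else (\<chi> j. if j = i then \<alpha> else a $ j) $ j)
      = (\<chi> j. if j = i then \<beta> else a $ j)" for \<beta>
    by (simp add: vec_eq_iff)
  then show ?thesis by (simp add: isection_def)
qed

lemma isection_downshift: "isection i (downshift i V) a = {0..<card (isection i V a)}"
proof -
  have "isection i (downshift i V) a
      = {\<alpha>. \<alpha> < card (isection i V (\<chi> j. if j = i then \<alpha> else a $ j))}"
    by (subst isection_def) (simp add: downshift_def)
  also have "\<dots> = {\<alpha>. \<alpha> < card (isection i V a)}"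
    by (simp only: isection_upd)
  also have "\<dots> = {0..<card (isection i V a)}"
    by (simp add: atLeast0LessThan lessThan_def)
  finally show ?thesis .
qed

lemma downshift_unique:
  assumes "\<And>a. isection i W a = {0..<card (isection i V a)}"
  shows "W = downshift i V"
proof (rule set_eqI)
  fix a
  show "a \<in> W \<longleftrightarrow> a \<in> downshift i V"
    by (simp only: isection_self [of a _ i] assms isection_downshift)
qed

lemma downshift_subset_cube:
  assumes "V \<subseteq> cube k"
  shows "downshift i V \<subseteq> cube k"
proof
  fix a assume "a \<in> downshift i V"
  then have less: "a $ i < card (isection i V a)" by (simp add: downshift_def)
  have upd: "(if j = i then \<alpha> else a $ j) < k" if "\<alpha> \<in> isection i V a" for \<alpha> j
  proof -
    have "(\<chi> j. if j = i then \<alpha> else a $ j) \<in> cube k"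
      using that assms unfolding isection_def by blast
    then have "(\<chi> j. if j = i then \<alpha> else a $ j) $ j < k"
      unfolding cube_def by simp
    then show ?thesis by simp
  qed
  have "isection i V a \<subseteq> {0..<k}"
    using upd [of _ i] by auto
  then have "card (isection i V a) \<le> k"
    using card_mono [of "{0..<k}"] by simp
  with less have "a $ i < k" by simp
  moreover have "a $ j < k" if "j \<noteq> i" for j
  proof -
    from less have "isection i V a \<noteq> {}" by (metis card.empty not_less0)
    then obtain \<alpha> where "\<alpha> \<in> isection i V a" by blast
    from upd [OF this, of j] that show ?thesis by simp
  qed
  ultimately have "a $ j < k" for j
    by (cases "j = i") simp_all
  then show "a \<in> cube k" by (simp add: cube_def)
qed

end

theory Submission
  imports Defs "HOL-Computational_Algebra.Polynomial"
begin

text \<open>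
  Induction on the list of variables. Let \<open>i\<close> be the largest variable, let \<open>d\<close> be the
  \<open>i\<close>-exponent of \<open>w\<close>, and let \<open>w'\<close> be the rest of \<open>w\<close>. Let \<open>V'\<close> be the set of points, in the
  remaining coordinates, at which the \<open>i\<close>-section of \<open>V\<close> has more than \<open>d\<close> elements; this is the
  slice of \<open>downshift i V\<close> at height \<open>d\<close>. Then \<open>w\<close> is a leading monomial of the ideal of \<open>V\<close>
  iff \<open>w'\<close> is one of the ideal of \<open>V'\<close>. If \<open>f\<close> vanishes on \<open>V\<close> and has leading monomial \<open>w\<close>, it
  has degree \<open>d\<close> in \<open>x\<^sub>i\<close>, so over a point of \<open>V'\<close> it has too many roots, and its top coefficient
  vanishes on \<open>V'\<close>. Conversely, if \<open>g\<close> vanishes on \<open>V'\<close> and has leading monomial \<open>w'\<close>, then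
  \<open>g x\<^sub>i\<^sup>d\<close> agrees on \<open>V\<close> with a polynomial of degree less than \<open>d\<close> in \<open>x\<^sub>i\<close>: interpolate it over
  each section with at most \<open>d\<close> elements, then interpolate the coefficients.
\<close>

section \<open>Interpolation\<close>

text \<open>Newton's step: a multiple of the product of the \<open>X - s\<close> corrects the value
  at a new node and leaves the old ones alone. The degree bound is put on coefficients so that
  \<open>S = {}\<close> forces the zero polynomial.\<close>

lemma poly_interpolation:
  fixes F :: "'a::field \<Rightarrow> 'a"
  assumes "finite S"
  shows "\<exists>p. (\<forall>e\<ge>card S. coeff p e = 0) \<and> (\<forall>t\<in>S. poly p t = F t)"
  using assms
proof (induction S)
  case empty
  show ?case by (intro exI[of _ 0]) simp
next
  case (insert a S)
  then obtain p where p: "\<And>e. e \<ge> card S \<Longrightarrow> coeff p e = 0" "\<And>t. t \<in> S \<Longrightarrow> poly p t = F t"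
    by blast
  define q where "q = (\<Prod>s\<in>S. [:- s, 1:])"
  have deg: "degree q = card S"
    unfolding q_def by (subst degree_prod_eq_sum_degree) auto
  have root: "poly q s = 0" if "s \<in> S" for s
    using that insert.hyps by (auto simp: q_def poly_prod intro!: prod_zero)
  have nz: "poly q a \<noteq> 0"
    using insert.hyps by (auto simp: q_def poly_prod)
  define r where "r = p + smult ((F a - poly p a) / poly q a) q"
  have "coeff r e = 0" if "e \<ge> card (insert a S)" for e
    using that insert.hyps p(1)[of e] deg by (simp add: r_def coeff_eq_0)
  moreover have "poly r t = F t" if "t \<in> insert a S" for t
    using that p(2) root nz by (auto simp: r_def)
  ultimately show ?case by blast
qed

lemma poly_eq_sum_coeff:
  fixes p :: "'a::comm_semiring_1 poly"
  assumes "\<And>e. e \<ge> n \<Longrightarrow> coeff p e = 0"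
  shows "poly p t = (\<Sum>e<n. coeff p e * t ^ e)"
proof -
  have "poly p t = (\<Sum>e\<le>degree p. coeff p e * t ^ e)"
    by (rule poly_altdef)
  also have "\<dots> = (\<Sum>e<max n (Suc (degree p)). coeff p e * t ^ e)"
    by (rule sum.mono_neutral_left) (auto simp: coeff_eq_0)
  also have "\<dots> = (\<Sum>e<n. coeff p e * t ^ e)"
    by (rule sum.mono_neutral_right) (auto simp: assms)
  finally show ?thesis .
qed

section \<open>Functions of points given by polynomials in some of the coordinates\<close>

definition vec_upd :: "'n::finite \<Rightarrow> 'a \<Rightarrow> 'a ^ 'n \<Rightarrow> 'a ^ 'n" where
  "vec_upd i t v = (\<chi> j. if j = i then t else v $ j)"

lemma vec_upd_nth [simp]: "vec_upd i t v $ j = (if j = i then t else v $ j)"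
  by (simp add: vec_upd_def)

lemma mem_isection: "t \<in> isection i V a \<longleftrightarrow> vec_upd i t a \<in> V"
  by (simp add: isection_def vec_upd_def)

text \<open>Restricting a monomial to \<open>S\<close> lets variables be removed one by one while
  the index type stays fixed.\<close>

definition power_on :: "'n set \<Rightarrow> nat ^ 'n::finite \<Rightarrow> nat ^ 'n \<Rightarrow> 'a::field_char_0" where
  "power_on S u v = (\<Prod>i\<in>S. of_nat (v $ i) ^ (u $ i))"

text \<open>The linear span of the monomials with exponents in \<open>B\<close>, taken as functions:
  only values at points matter until actual polynomials return for the leading monomials.\<close>

inductive_set poly_functions ::
    "'n set \<Rightarrow> (nat ^ 'n::finite) set \<Rightarrow> (nat ^ 'n \<Rightarrow> 'a::field_char_0) set"
  for S :: "'n set" and B :: "(nat ^ 'n) set" where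
  zero: "(\<lambda>v. 0) \<in> poly_functions S B"
| step: "F \<in> poly_functions S B \<Longrightarrow> u \<in> B \<Longrightarrow>
    (\<lambda>v. c * power_on S u v + F v) \<in> poly_functions S B"

lemma power_on_insert:
  "i \<notin> S \<Longrightarrow> power_on (insert i S) u v = of_nat (v $ i) ^ (u $ i) * power_on S u v"
  by (simp add: power_on_def)

lemma power_on_cong:
  assumes "\<And>j. j \<in> S \<Longrightarrow> u $ j = u' $ j" "\<And>j. j \<in> S \<Longrightarrow> v $ j = v' $ j"
  shows "power_on S u v = power_on S u' v'"
  using assms by (simp add: power_on_def)

lemma power_on_vec_upd:
  assumes "i \<notin> S"
  shows "power_on S u (vec_upd i t v) = power_on S u v" "power_on S (vec_upd i e u) v = power_on S u v"
  by (rule power_on_cong; use assms in auto)+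

lemma poly_functions_depends:
  fixes F :: "nat ^ 'n::finite \<Rightarrow> 'a::field_char_0"
  assumes "F \<in> poly_functions S B" "\<And>j. j \<in> S \<Longrightarrow> v $ j = v' $ j"
  shows "F v = F v'"
  using assms(1)
proof induction
  case (step F u c)
  have "power_on S u v = (power_on S u v' :: 'a)"
    by (rule power_on_cong) (use assms(2) in auto)
  with step.IH show ?case by simp
qed simp

lemma poly_functions_add:
  assumes "F \<in> poly_functions S B" "G \<in> poly_functions S B"
  shows "(\<lambda>v. F v + G v) \<in> poly_functions S B"
  using assms(1)
proof induction
  case (step F u c)
  from poly_functions.step[OF step.IH step.hyps(2), of c] show ?case
    by (simp add: add.assoc)
qed (use assms(2) in simp)

lemma poly_functions_sum:
  assumes "finite A" "\<And>e. e \<in> A \<Longrightarrow> F e \<in> poly_functions S B"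
  shows "(\<lambda>v. \<Sum>e\<in>A. F e v) \<in> poly_functions S B"
  using assms by induction (auto intro: poly_functions.zero poly_functions_add)

lemma poly_functions_power_on:
  assumes "u \<in> B"
  shows "(\<lambda>v. c * power_on S u v) \<in> poly_functions S B"
  using poly_functions.step[OF poly_functions.zero assms, of c S] by simp

lemma poly_functions_mult_power:
  fixes F :: "nat ^ 'n::finite \<Rightarrow> 'a::field_char_0"
  assumes "F \<in> poly_functions S B" "i \<notin> S" "\<And>u. u \<in> B \<Longrightarrow> vec_upd i e u \<in> C"
  shows "(\<lambda>v. F v * of_nat (v $ i) ^ e) \<in> poly_functions (insert i S) C"
  using assms(1)
proof induction
  case zero
  then show ?case by (simp add: poly_functions.zero)
next
  case (step F u c)
  have "power_on (insert i S) (vec_upd i e u) v = (of_nat (v $ i) ^ e * power_on S u v :: 'a)" for v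
    using assms(2) by (simp add: power_on_insert power_on_vec_upd)
  with poly_functions.step[OF step.IH assms(3)[OF step.hyps(2)], of c] show ?case
    by (simp add: algebra_simps)
qed

text \<open>One variable at a time: with the other coordinates fixed, interpolate in
  \<open>x_i\<close> at the nodes \<open>0, ..., k - 1\<close>, which are distinct in characteristic
  0. The coefficients are functions of the remaining coordinates and fall under the induction
  hypothesis.\<close>

lemma poly_functions_interpolation:
  fixes F :: "nat ^ 'n::finite \<Rightarrow> 'a::field_char_0"
  assumes "finite S" "\<And>v v'. (\<And>j. j \<in> S \<Longrightarrow> v $ j = v' $ j) \<Longrightarrow> F v = F v'"
  shows "\<exists>G\<in>poly_functions S {u. \<forall>j. j \<notin> S \<longrightarrow> u $ j = w $ j}. \<forall>v\<in>cube k. G v = F v"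
  using assms
proof (induction S arbitrary: F)
  case empty
  have "power_on {} w v = (1::'a)" for v
    by (simp add: power_on_def)
  moreover have "F 0 = F v" for v
    by (rule empty.prems) simp
  ultimately show ?case
    using poly_functions_power_on[of w "{u. \<forall>j. j \<notin> {} \<longrightarrow> u $ j = w $ j}" "F 0" "{}"]
    by (intro bexI[where x = "\<lambda>v. F 0 * power_on {} w v"]) auto
next
  case (insert i S)
  let ?B = "\<lambda>S. {u. \<forall>j. j \<notin> S \<longrightarrow> u $ j = w $ j}"
  have "\<exists>p. (\<forall>e\<ge>k. coeff p e = 0) \<and> (\<forall>t<k. poly p (of_nat t) = (f t::'a))" for f
  proof -
    have "card (of_nat ` {..<k} :: 'a set) = k"
      by (subst card_image) (auto simp: inj_on_def)
    with poly_interpolation[of "of_nat ` {..<k}" "\<lambda>x. f (inv of_nat x)"] show ?thesis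
      by (auto simp: inj_of_nat inv_f_f)
  qed
  \<comment> \<open>\<open>p\<close> takes the whole table of values \<open>f\<close>, so equal
    tables get the same polynomial; hence \<open>H e\<close> below depends on the coordinates in
    \<open>S\<close> only.\<close>
  then obtain p where p: "\<And>f e. e \<ge> k \<Longrightarrow> coeff (p f) e = 0"
    "\<And>f t. t < k \<Longrightarrow> poly (p f) (of_nat t) = (f t::'a)"
    by metis
  define H where "H e v = coeff (p (\<lambda>t. F (vec_upd i t v))) e" for e v
  have "H e v = H e v'" if "\<And>j. j \<in> S \<Longrightarrow> v $ j = v' $ j" for e v v'
  proof -
    have "(\<lambda>t. F (vec_upd i t v)) = (\<lambda>t. F (vec_upd i t v'))"
      by (intro ext insert.prems) (use that in auto)
    then show ?thesis by (simp add: H_def)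
  qed
  then have "\<forall>e. \<exists>G. G \<in> poly_functions S (?B S) \<and> (\<forall>v\<in>cube k. G v = H e v)"
    using insert.IH by blast
  from choice[OF this] obtain G where G: "\<And>e. G e \<in> poly_functions S (?B S)"
    "\<And>e v. v \<in> cube k \<Longrightarrow> G e v = H e v"
    by blast
  let ?G = "\<lambda>v. \<Sum>e<k. G e v * of_nat (v $ i) ^ e"
  have "?G \<in> poly_functions (insert i S) (?B (insert i S))"
    by (intro poly_functions_sum poly_functions_mult_power[OF G(1)]) (use insert.hyps in auto)
  moreover have "?G v = F v" if v: "v \<in> cube k" for v
  proof -
    have "v $ i < k"
      using v by (simp add: cube_def)
    have "?G v = (\<Sum>e<k. H e v * of_nat (v $ i) ^ e)"
      by (simp add: G(2)[OF v])
    also have "\<dots> = poly (p (\<lambda>t. F (vec_upd i t v))) (of_nat (v $ i))"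
      unfolding H_def by (rule poly_eq_sum_coeff[symmetric]) (rule p(1))
    also have "\<dots> = F (vec_upd i (v $ i) v)"
      by (rule p(2)) fact
    also have "\<dots> = F v"
      by (rule insert.prems) simp
    finally show ?thesis .
  qed
  ultimately show ?case by (intro bexI[of _ ?G] ballI)
qed

section \<open>Elimination of the largest variable\<close>

lemma lex_less_Nil [simp]: "\<not> lex_less [] u w"
  by (simp add: lex_less_def)

lemma lex_less_Cons:
  "lex_less (i # js) u w \<longleftrightarrow> u $ i < w $ i \<or> u $ i = w $ i \<and> lex_less js u w"
  unfolding lex_less_def list.size add_Suc_right add_0_right Ex_less_Suc2 All_less_Suc2
  by auto

lemma lex_less_irrefl: "\<not> lex_less idx w w"
  by (simp add: lex_less_def)

text \<open>Exponents outside \<open>idx\<close> are frozen at those of \<open>w\<close>, so that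
  these monomials remain smaller than \<open>w\<close> when larger variables are put back in
  front.\<close>

definition lex_below :: "'n::finite list \<Rightarrow> nat ^ 'n \<Rightarrow> (nat ^ 'n) set" where
  "lex_below idx w = {u. (\<forall>j. j \<notin> set idx \<longrightarrow> u $ j = w $ j) \<and> lex_less idx u w}"

text \<open>This encodes that \<open>w\<close> is a leading monomial of the ideal of
  \<open>V\<close>: the polynomial is divided by its leading coefficient and the leading term moved
  to the other side. The \<open>itself\<close> argument names the field, which occurs in no other
  argument.\<close>

definition reducible ::
  "'a::field_char_0 itself \<Rightarrow> 'n::finite list \<Rightarrow> (nat ^ 'n) set \<Rightarrow> nat ^ 'n \<Rightarrow> bool" where
  "reducible _ idx V w \<longleftrightarrow>
    (\<exists>F\<in>poly_functions (set idx) (lex_below idx w). \<forall>v\<in>V. F v = (power_on (set idx) w v :: 'a))"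

text \<open>Collecting \<open>F\<close> by powers of \<open>x_i\<close> gives \<open>q\<close>, with
  coefficients in the other variables. A monomial below \<open>w\<close> has
  \<open>i\<close>-exponent at most \<open>w $ i\<close>, and one that attains it is below
  \<open>w\<close> with respect to \<open>js\<close>.\<close>

lemma poly_functions_leading_coeff:
  fixes F :: "nat ^ 'n::finite \<Rightarrow> 'a::field_char_0"
  assumes "F \<in> poly_functions (set (i # js)) (lex_below (i # js) w)" "i \<notin> set js"
  shows "\<exists>q. (\<forall>v. F v = poly (q v) (of_nat (v $ i))) \<and> (\<forall>v t. q (vec_upd i t v) = q v) \<and>
    (\<forall>v. degree (q v) \<le> w $ i) \<and>
    (\<lambda>v. coeff (q v) (w $ i)) \<in> poly_functions (set js) (lex_below js w)"
  using assms(1)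
proof induction
  case zero
  show ?case by (intro exI[of _ "\<lambda>v. 0"]) (simp add: poly_functions.zero)
next
  case (step F u c)
  then obtain q where q: "\<And>v. F v = poly (q v) (of_nat (v $ i))"
    "\<And>v t. q (vec_upd i t v) = q v" "\<And>v. degree (q v) \<le> w $ i"
    "(\<lambda>v. coeff (q v) (w $ i)) \<in> poly_functions (set js) (lex_below js w)"
    by blast
  define r where "r v = monom (c * power_on (set js) u v) (u $ i) + q v" for v
  have u: "u $ i \<le> w $ i" "u $ i = w $ i \<Longrightarrow> u \<in> lex_below js w"
    using step.hyps(2) by (auto simp: lex_below_def lex_less_Cons)
  have "c * power_on (set (i # js)) u v + F v = poly (r v) (of_nat (v $ i))" for v
    using assms(2) by (simp add: r_def q(1) power_on_insert poly_monom)
  moreover have "r (vec_upd i t v) = r v" for v t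
    using assms(2) by (simp add: r_def q(2) power_on_vec_upd)
  moreover have "degree (r v) \<le> w $ i" for v
    unfolding r_def by (intro degree_add_le q(3) order.trans[OF degree_monom_le u(1)])
  moreover have "(\<lambda>v. coeff (r v) (w $ i)) \<in> poly_functions (set js) (lex_below js w)"
  proof (cases "u $ i = w $ i")
    case True
    from poly_functions.step[OF q(4) u(2)[OF True], of c] show ?thesis
      by (simp add: r_def True)
  next
    case False
    then show ?thesis using q(4) by (simp add: r_def)
  qed
  ultimately show ?case by blast
qed

lemma finite_isection:
  assumes "V \<subseteq> cube k"
  shows "finite (isection i V a)"
proof (rule finite_subset)
  show "isection i V a \<subseteq> {..<k}"
  proof
    fix t assume "t \<in> isection i V a"
    then have "vec_upd i t a \<in> cube k"
      using assms by (auto simp: mem_isection)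
    then have "vec_upd i t a $ i < k"
      by (simp only: cube_def mem_Collect_eq atLeastLessThan_iff)
    then show "t \<in> {..<k}" by simp
  qed
qed simp

lemma reducible_Cons_imp:
  fixes V :: "(nat ^ 'n::finite) set"
  assumes "reducible TYPE('a::field_char_0) (i # js) V w" "i \<notin> set js"
  shows "reducible TYPE('a) js {a \<in> downshift i V. a $ i = w $ i} w"
proof -
  obtain F where F: "F \<in> poly_functions (set (i # js)) (lex_below (i # js) w)"
    "\<And>v. v \<in> V \<Longrightarrow> F v = (power_on (set (i # js)) w v :: 'a)"
    using assms(1) by (auto simp: reducible_def)
  obtain q where q: "\<And>v. F v = poly (q v) (of_nat (v $ i))"
    "\<And>v t. q (vec_upd i t v) = q v" "\<And>v. degree (q v) \<le> w $ i"
    "(\<lambda>v. coeff (q v) (w $ i)) \<in> poly_functions (set js) (lex_below js w)"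
    using poly_functions_leading_coeff[OF F(1) assms(2)] by blast
  have "coeff (q b) (w $ i) = power_on (set js) w b"
    if b: "b \<in> downshift i V" "b $ i = w $ i" for b
  proof -
    \<comment> \<open>This is \<open>x^w - F\<close> as a polynomial in \<open>x_i\<close>, the
      other coordinates being those of \<open>b\<close>. Its degree is at most \<open>w $ i\<close>,
      and the section, which has more elements, consists of roots.\<close>
    define r where "r = monom (power_on (set js) w b) (w $ i) - q b"
    have deg: "degree r \<le> w $ i"
      unfolding r_def by (intro degree_diff_le q(3) degree_monom_le)
    have roots: "of_nat ` isection i V b \<subseteq> {x. poly r x = 0}"
    proof safe
      fix t assume "t \<in> isection i V b"
      then have "vec_upd i t b \<in> V" by (simp add: mem_isection)
      from F(2)[OF this] show "poly r (of_nat t) = 0"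
        using assms(2) by (simp add: r_def q(1,2) power_on_insert power_on_vec_upd poly_monom)
    qed
    have "r = 0"
    proof (rule ccontr)
      assume "r \<noteq> 0"
      then have "card (of_nat ` isection i V b :: 'a set) \<le> degree r"
        using card_mono[OF poly_roots_finite roots] card_poly_roots_bound[of r] by fastforce
      moreover have "card (of_nat ` isection i V b :: 'a set) = card (isection i V b)"
        by (rule card_image) (auto simp: inj_on_def)
      ultimately show False
        using deg b by (simp add: downshift_def)
    qed
    then have "coeff r (w $ i) = 0" by simp
    then show ?thesis by (simp add: r_def)
  qed
  with q(4) show ?thesis
    unfolding reducible_def by (intro bexI[of _ "\<lambda>v. coeff (q v) (w $ i)"]) auto
qed

lemma reducible_Cons_if:
  fixes V :: "(nat ^ 'n::finite) set"
  assumes "reducible TYPE('a::field_char_0) js {a \<in> downshift i V. a $ i = w $ i} w" "i \<notin> set js"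
    and V: "V \<subseteq> cube k" "\<And>v j. v \<in> V \<Longrightarrow> j \<notin> set (i # js) \<Longrightarrow> v $ j = w $ j"
  shows "reducible TYPE('a) (i # js) V w"
proof -
  let ?d = "w $ i"
  let ?B = "{u. \<forall>j. j \<notin> set js \<longrightarrow> u $ j = w $ j}"
  obtain g where g: "g \<in> poly_functions (set js) (lex_below js w)"
    "\<And>v. v \<in> downshift i V \<Longrightarrow> v $ i = ?d \<Longrightarrow> g v = (power_on (set js) w v :: 'a)"
    using assms(1) by (auto simp: reducible_def)
  \<comment> \<open>The leading monomial is the sum of \<open>g\<close> and \<open>h\<close>, each
    times \<open>x_i^?d\<close>. The first part is already below \<open>w\<close>; only the second
    has to be lowered in \<open>x_i\<close>.\<close>
  define h where "h v = power_on (set js) w v - g v" for v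
  have h_cong: "h v = h v'" if "\<And>j. j \<in> set js \<Longrightarrow> v $ j = v' $ j" for v v'
    using poly_functions_depends[OF g(1), of v v'] power_on_cong[of "set js" w w v v'] that
    by (simp add: h_def)
  have "\<exists>p. (\<forall>e\<ge>?d. coeff p e = 0) \<and>
    (\<forall>t\<in>isection i V v. poly p (of_nat t) = h v * of_nat t ^ ?d)" for v
  proof (cases "card (isection i V v) \<le> ?d")
    case True
    have "card (of_nat ` isection i V v :: 'a set) = card (isection i V v)"
      by (rule card_image) (auto simp: inj_on_def)
    with True show ?thesis
      using poly_interpolation[of "of_nat ` isection i V v" "\<lambda>x. h v * x ^ ?d"]
        finite_isection[OF V(1), of i v] by (auto intro: order.trans)
  next
    case False
    \<comment> \<open>Over a large section the point at height \<open>?d\<close> lies in the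
      downshift, where \<open>h\<close> is zero; as \<open>h\<close> does not see the coordinate
      \<open>i\<close>, the zero polynomial serves.\<close>
    have "isection i V (vec_upd i ?d v) = isection i V v"
      unfolding vec_upd_def by (rule isection_upd)
    with False have "vec_upd i ?d v \<in> downshift i V"
      by (simp add: downshift_def)
    then have "h (vec_upd i ?d v) = 0"
      by (simp add: h_def g(2))
    moreover have "h (vec_upd i ?d v) = h v"
      by (rule h_cong) (use assms(2) in auto)
    ultimately show ?thesis
      by (intro exI[of _ 0]) simp
  qed
  then obtain p where p: "\<And>v e. e \<ge> ?d \<Longrightarrow> coeff (p v) e = 0"
    "\<And>v t. t \<in> isection i V v \<Longrightarrow> poly (p v) (of_nat t) = h v * of_nat t ^ ?d"
    by metis
  \<comment> \<open>The choice of \<open>p\<close> is made to depend only on the coordinates in \<open>js\<close>.\<close>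
  define norm where "norm v = (\<chi> j. if j \<in> set js then v $ j else w $ j)" for v
  have norm_cong: "norm v = norm v'" if "\<And>j. j \<in> set js \<Longrightarrow> v $ j = v' $ j" for v v'
    using that by (simp add: norm_def vec_eq_iff)
  have "\<exists>G\<in>poly_functions (set js) ?B. \<forall>v\<in>cube k. G v = coeff (p (norm v)) e" for e
    by (intro poly_functions_interpolation arg_cong[of _ _ "\<lambda>x. coeff (p x) e"] norm_cong) auto
  then have "\<forall>e. \<exists>G. G \<in> poly_functions (set js) ?B \<and>
      (\<forall>v\<in>cube k. G v = coeff (p (norm v)) e)"
    by blast
  from choice[OF this] obtain G where G: "\<And>e. G e \<in> poly_functions (set js) ?B"
    "\<And>e v. v \<in> cube k \<Longrightarrow> G e v = coeff (p (norm v)) e"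
    by blast
  let ?F = "\<lambda>v. g v * of_nat (v $ i) ^ ?d + (\<Sum>e<?d. G e v * of_nat (v $ i) ^ e)"
  have below: "vec_upd i ?d u \<in> lex_below (i # js) w" if "u \<in> lex_below js w" for u
  proof -
    have "vec_upd i ?d u = u"
      using that assms(2) by (simp add: lex_below_def vec_eq_iff)
    then show ?thesis
      using that assms(2) by (simp add: lex_below_def lex_less_Cons)
  qed
  have lower: "vec_upd i e u \<in> lex_below (i # js) w" if "u \<in> ?B" "e < ?d" for e u
    using that by (simp add: lex_below_def lex_less_Cons)
  have "?F \<in> poly_functions (set (i # js)) (lex_below (i # js) w)"
    unfolding list.set
    by (intro poly_functions_add poly_functions_sum poly_functions_mult_power[OF g(1)]
        poly_functions_mult_power[OF G(1)] assms(2) below lower) auto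
  moreover have "?F v = power_on (set (i # js)) w v" if v: "v \<in> V" for v
  proof -
    \<comment> \<open>Points of \<open>V\<close> agree with \<open>w\<close> outside
      \<open>i # js\<close>, so \<open>norm v\<close> and \<open>v\<close> differ at most at
      \<open>i\<close>.\<close>
    have "vec_upd i (v $ i) (norm v) = v"
      using V(2)[OF v] by (auto simp: norm_def vec_eq_iff)
    then have sec: "v $ i \<in> isection i V (norm v)"
      using v by (simp add: mem_isection)
    have "(\<Sum>e<?d. G e v * of_nat (v $ i) ^ e) = poly (p (norm v)) (of_nat (v $ i))"
      using v V(1) by (subst poly_eq_sum_coeff[OF p(1)]) (auto simp: G(2) subset_iff)
    also have "\<dots> = h (norm v) * of_nat (v $ i) ^ ?d"
      using sec by (rule p(2))
    also have "h (norm v) = h v"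
      by (rule h_cong) (simp add: norm_def)
    finally show ?thesis
      using assms(2) by (simp add: h_def power_on_insert algebra_simps)
  qed
  ultimately show ?thesis
    unfolding reducible_def by (intro bexI[of _ ?F] ballI)
qed

text \<open>A downshift in a direction other than \<open>i\<close> acts separately on each
  hyperplane of constant \<open>i\<close>-coordinate.\<close>

lemma downshifts_slice_cong:
  assumes "i \<notin> set js" "\<And>a. a $ i = d \<Longrightarrow> a \<in> V \<longleftrightarrow> a \<in> W" "a $ i = d"
  shows "a \<in> downshifts js V \<longleftrightarrow> a \<in> downshifts js W"
  using assms(1,3)
proof (induction js arbitrary: a)
  case Nil
  then show ?case by (simp add: assms(2))
next
  case (Cons j js)
  then have "isection j (downshifts js V) a = isection j (downshifts js W) a"
    by (auto simp: mem_isection)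
  then show ?case by (simp add: downshift_def)
qed

lemma downshifts_append: "downshifts (js @ ls) V = downshifts js (downshifts ls V)"
  by (simp add: downshifts_def)

text \<open>The largest variable is eliminated first, so its downshift is the innermost one; hence
  \<open>rev\<close>. Agreement with \<open>w\<close> outside \<open>idx\<close> records the
  coordinates already eliminated, so that in the end at most the point \<open>w\<close> is
  left.\<close>

lemma reducible_iff_not_in_downshifts:
  fixes V :: "(nat ^ 'n::finite) set"
  assumes "distinct idx" "V \<subseteq> cube k" "\<And>v j. v \<in> V \<Longrightarrow> j \<notin> set idx \<Longrightarrow> v $ j = w $ j"
  shows "reducible TYPE('a::field_char_0) idx V w \<longleftrightarrow> w \<notin> downshifts (rev idx) V"
  using assms
proof (induction idx arbitrary: V)
  case Nil
  have "F = (\<lambda>v. 0)" if "F \<in> poly_functions {} {}" for F :: "nat ^ 'n \<Rightarrow> 'a"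
    using that by induction auto
  then have "poly_functions {} {} = {\<lambda>v :: nat ^ 'n. 0 :: 'a}"
    using poly_functions.zero by blast
  \<comment> \<open>With no variables left, the monomial is \<open>1\<close> and nothing is below
    it, so reducibility asks for \<open>0 = 1\<close> at every point of \<open>V\<close>.\<close>
  then have "reducible TYPE('a) [] V w \<longleftrightarrow> V = {}"
    by (auto simp: reducible_def lex_below_def power_on_def)
  moreover have "v = w" if "v \<in> V" for v
    using Nil.prems(3)[OF that] by (simp add: vec_eq_iff)
  ultimately show ?case by auto
next
  case (Cons i js)
  let ?W = "{a \<in> downshift i V. a $ i = w $ i}"
  have i: "i \<notin> set js" using Cons.prems(1) by simp
  \<comment> \<open>Shifting along \<open>i\<close> changes no other coordinate, and the slice fixes
    the one at \<open>i\<close>.\<close>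
  have out: "v $ j = w $ j" if "v \<in> ?W" "j \<notin> set js" for v j
  proof (cases "j = i")
    case False
    from that(1) have "isection i V v \<noteq> {}"
      by (auto simp: downshift_def)
    then obtain t where "vec_upd i t v \<in> V"
      by (auto simp: mem_isection)
    from Cons.prems(3)[OF this, of j] show ?thesis
      using False that(2) by simp
  qed (use that in simp)
  have "reducible TYPE('a) (i # js) V w \<longleftrightarrow> reducible TYPE('a) js ?W w"
    using reducible_Cons_imp[OF _ i] reducible_Cons_if[OF _ i Cons.prems(2,3)] by blast
  also have "\<dots> \<longleftrightarrow> w \<notin> downshifts (rev js) ?W"
  proof (rule Cons.IH)
    show "distinct js" using Cons.prems(1) by simp
    show "?W \<subseteq> cube k" using downshift_subset_cube[OF Cons.prems(2)] by blast
  qed (rule out)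
  also have "\<dots> \<longleftrightarrow> w \<notin> downshifts (rev js) (downshift i V)"
    using downshifts_slice_cong[of i "rev js" "w $ i" ?W "downshift i V" w] i by simp
  finally show ?case by (simp add: downshifts_append)
qed

section \<open>Leading monomials\<close>

lemma eval_eq_sum:
  assumes "finite A" "Poly_Mapping.keys f \<subseteq> A"
  shows "eval f v = (\<Sum>w\<in>A. Poly_Mapping.lookup f w * (\<Prod>i\<in>UNIV. (v $ i) ^ (w $ i)))"
  unfolding eval_def
  by (rule sum.mono_neutral_left) (use assms in \<open>auto simp: in_keys_iff\<close>)

lemma eval_add: "eval (f + g) v = eval f v + eval g v"
proof -
  let ?A = "Poly_Mapping.keys f \<union> Poly_Mapping.keys g"
  have "Poly_Mapping.keys (f + g) \<subseteq> ?A" by (rule keys_add)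
  then show ?thesis
    using eval_eq_sum[of ?A f v] eval_eq_sum[of ?A g v] eval_eq_sum[of ?A "f + g" v]
    by (simp add: lookup_add distrib_right sum.distrib)
qed

lemma eval_single:
  "eval (Poly_Mapping.single u c) v = c * (\<Prod>i\<in>UNIV. (v $ i) ^ (u $ i))"
  by (subst eval_eq_sum[of "{u}"]) auto

lemma power_on_UNIV: "power_on UNIV u v = (\<Prod>i\<in>UNIV. (rat_point v $ i) ^ (u $ i))"
  by (simp add: power_on_def rat_point_def)

text \<open>Terms may cancel when they are collected into a polynomial, but this only removes
  exponents, so the support stays in \<open>B\<close>.\<close>

lemma poly_functions_eval:
  assumes "F \<in> poly_functions UNIV B"
  shows "\<exists>f. Poly_Mapping.keys f \<subseteq> B \<and> (\<forall>v. eval f (rat_point v) = F v)"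
  using assms
proof induction
  case zero
  show ?case by (intro exI[of _ 0]) (simp add: eval_def)
next
  case (step F u c)
  then obtain f where f: "Poly_Mapping.keys f \<subseteq> B" "\<And>v. eval f (rat_point v) = F v"
    by blast
  have "Poly_Mapping.keys (Poly_Mapping.single u c + f) \<subseteq> B"
    using keys_add[of "Poly_Mapping.single u c" f] f(1) step.hyps(2)
    by (auto split: if_splits)
  then show ?case
    using f(2) by (intro exI[of _ "Poly_Mapping.single u c + f"])
      (simp add: eval_add eval_single power_on_UNIV)
qed

lemma leading_monomial_iff_reducible:
  assumes "set idx = UNIV"
  shows "(\<exists>f\<in>vanishing_ideal (rat_point ` V). f \<noteq> 0 \<and> is_leading_monomial (lex_less idx) f w)
    \<longleftrightarrow> reducible TYPE(rat) idx V w"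
proof
  assume "\<exists>f\<in>vanishing_ideal (rat_point ` V). f \<noteq> 0 \<and> is_leading_monomial (lex_less idx) f w"
  then obtain f where f: "\<And>v. v \<in> V \<Longrightarrow> eval f (rat_point v) = 0"
    "w \<in> Poly_Mapping.keys f"
    "\<And>u. u \<in> Poly_Mapping.keys f \<Longrightarrow> u \<noteq> w \<Longrightarrow> lex_less idx u w"
    by (auto simp: vanishing_ideal_def is_leading_monomial_def)
  let ?c = "Poly_Mapping.lookup f"
  let ?A = "Poly_Mapping.keys f - {w}"
  let ?F = "\<lambda>v. \<Sum>u\<in>?A. - ?c u / ?c w * power_on UNIV u v"
  have "?F \<in> poly_functions UNIV (lex_below idx w)"
    by (intro poly_functions_sum poly_functions_power_on)
      (use f(3) in \<open>auto simp: lex_below_def assms\<close>)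
  moreover have "?F v = power_on UNIV w v" if v: "v \<in> V" for v
  proof -
    \<comment> \<open>The vanishing relation is solved for its leading term, whose coefficient is
      nonzero.\<close>
    have "0 = ?c w * power_on UNIV w v + (\<Sum>u\<in>?A. ?c u * power_on UNIV u v)"
      using f(1)[OF v] f(2) by (simp add: eval_def power_on_UNIV sum.remove)
    then have "power_on UNIV w v = - (\<Sum>u\<in>?A. ?c u * power_on UNIV u v) / ?c w"
      using f(2) by (simp add: in_keys_iff field_simps eq_neg_iff_add_eq_0)
    also have "\<dots> = ?F v"
      by (simp add: sum_divide_distrib sum_negf)
    finally show ?thesis by simp
  qed
  ultimately show "reducible TYPE(rat) idx V w"
    unfolding reducible_def assms by (intro bexI[of _ ?F] ballI)
next
  assume "reducible TYPE(rat) idx V w"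
  then obtain F where F: "F \<in> poly_functions UNIV (lex_below idx w)"
    "\<And>v. v \<in> V \<Longrightarrow> F v = (power_on UNIV w v :: rat)"
    by (auto simp: reducible_def assms)
  obtain f where f: "Poly_Mapping.keys f \<subseteq> lex_below idx w"
    "\<And>v. eval f (rat_point v) = F v"
    using poly_functions_eval[OF F(1)] by blast
  \<comment> \<open>Every monomial of \<open>f\<close> is strictly below \<open>w\<close>, so the
    coefficient \<open>- 1\<close> at \<open>w\<close> survives and makes \<open>g\<close>
    nonzero.\<close>
  define g where "g = f + Poly_Mapping.single w (- 1)"
  have "w \<notin> Poly_Mapping.keys f"
    using f(1) lex_less_irrefl by (auto simp: lex_below_def)
  then have w: "w \<in> Poly_Mapping.keys g"
    by (simp add: g_def in_keys_iff lookup_add)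
  have "Poly_Mapping.keys g \<subseteq> insert w (lex_below idx w)"
    using keys_add[of f "Poly_Mapping.single w (- 1)"] f(1) by (auto simp: g_def)
  then have "is_leading_monomial (lex_less idx) g w"
    using w by (auto simp: is_leading_monomial_def lex_below_def)
  moreover have "g \<in> vanishing_ideal (rat_point ` V)"
    by (auto simp: vanishing_ideal_def g_def eval_add eval_single f(2) F(2) power_on_UNIV)
  moreover have "g \<noteq> 0" using w by auto
  ultimately show
    "\<exists>f\<in>vanishing_ideal (rat_point ` V). f \<noteq> 0 \<and> is_leading_monomial (lex_less idx) f w"
    by blast
qed

theorem theorem2:
  fixes k :: nat
    and V :: "(nat ^ 'n::finite) set"
    and idx :: "'n list"
  assumes "k \<ge> 1"
    and "V \<subseteq> cube k"
    and "distinct idx" and "set idx = UNIV"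
  shows "standard_monomials (lex_less idx) (vanishing_ideal (rat_point ` V))
    = downshifts (rev idx) V"
proof -
  have "reducible TYPE(rat) idx V w \<longleftrightarrow> w \<notin> downshifts (rev idx) V" for w
    by (rule reducible_iff_not_in_downshifts[OF assms(3,2)]) (simp add: assms(4))
  then show ?thesis
    by (simp add: standard_monomials_def leading_monomial_iff_reducible[OF assms(4)])
qed

end
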